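(* Assume that the physical energy pair satisfies $\nabla_u e(u)^\top A_k(u)=\nabla_u g_k(u)^\top$ for every $k$. Let $H(u)$ be the scalar-normalized physical energy metric, and let $G_k(u)$ and $\Delta A_k(u)$ be the symmetric energy-flux matrices and flux defects, all as defined in the context. Then every smooth solution $u(x,t)$ of $\partial_t u + A_k(u)\,\partial_{x_k}u=0$ satisfies $$u^\top H\,\Delta A_k\,\partial_{x_k}u+\tfrac12\,u^\top\Big[\partial_t H+\partial_{x_k}\{H(A_k+\Delta A_k)\}\Big]u=0 ,$$ where $H,A_k,\Delta A_k$ are evaluated at $u=u(x,t)$ and $\partial_t H$, $\partial_{x_k}\{\cdot\}$ denote derivatives of the composed fields, e.g. $\partial_t[H(u(x,t))]$.
   Context: Repeated spatial indices $k$ are summed over $k=1,\dots,d$. The system is $\partial_t u + A_k(u)\partial_{x_k}u=0$ with $x\in\mathbb R^d$, $u\in\mathbb R^m$ taking values in an admissible set $\mathcal U\subset\mathbb R^m$, and $A_k(u)=\partial_uF_k(u)\in\mathbb R^{m\times m}$ the Jacobian of a smooth flux $F_k$. A scalar physical energy density $e(u)$ with scalar energy fluxes $g_k(u)$ is given; all these functions are smooth. Assume $e(u)>0$ and the Hessian $\mathcal H_e(u)=\nabla_u^2e(u)$ is symmetric positive definite (SPD) on $\mathcal U$. The scalar-normalized physical energy metric is $$H(u):=\frac{2e(u)}{u^\top\mathcal H_e(u)u}\,\mathcal H_e(u),$$ so $H(u)$ is SPD and $e(u)=\tfrac12u^\top H(u)u$. Each energy flux is represented as $g_k(u)=\tfrac12u^\top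 G_k(u)u$ with $G_k(u)$ a smooth symmetric matrix field, and $\Delta A_k(u)$ is defined by $G_k(u)=H(u)[A_k(u)+\Delta A_k(u)]$. *)

theory Defs
  imports "HOL-Analysis.Analysis"
begin

text \<open>
  \<open>Ck_on n S f\<close>: \<open>f\<close> is \<open>n\<close> times continuously differentiable on the open set \<open>S\<close>.
  As \<open>at x\<close> is the full neighbourhood filter, the notion is only meant for open \<open>S\<close>.
\<close>

primrec Ck_on :: "nat \<Rightarrow> 'a::euclidean_space set \<Rightarrow> ('a \<Rightarrow> 'b::real_normed_vector) \<Rightarrow> bool" where
  "Ck_on 0 S f \<longleftrightarrow> continuous_on S f"
| "Ck_on (Suc n) S f \<longleftrightarrow>
     (\<forall>x\<in>S. f differentiable (at x)) \<and>
     (\<forall>v. Ck_on n S (\<lambda>x. frechet_derivative f (at x) v))"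

definition smooth_on :: "'a::euclidean_space set \<Rightarrow> ('a \<Rightarrow> 'b::real_normed_vector) \<Rightarrow> bool" where
  "smooth_on S f \<longleftrightarrow> (\<forall>n. Ck_on n S f)"

definition gradient :: "(real ^ 'm \<Rightarrow> real) \<Rightarrow> real ^ 'm \<Rightarrow> real ^ 'm" where
  "gradient f u = (\<chi> i. frechet_derivative f (at u) (axis i 1))"

definition hessian :: "(real ^ 'm \<Rightarrow> real) \<Rightarrow> real ^ 'm \<Rightarrow> real ^ 'm ^ 'm" where
  "hessian f u = jacobian (gradient f) (at u)"

definition symmetric_matrix :: "real ^ 'm ^ 'm \<Rightarrow> bool" where
  "symmetric_matrix M \<longleftrightarrow> transpose M = M"

definition spd_matrix :: "real ^ 'm ^ 'm \<Rightarrow> bool" where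
  "spd_matrix M \<longleftrightarrow> symmetric_matrix M \<and> (\<forall>v. v \<noteq> 0 \<longrightarrow> 0 < v \<bullet> (M *v v))"

text \<open>
  The scalar-normalized metric. It is meaningful for \<open>u \<noteq> 0\<close> only: at \<open>u = 0\<close> the
  denominator vanishes.
\<close>

definition energy_metric :: "(real ^ 'm \<Rightarrow> real) \<Rightarrow> real ^ 'm \<Rightarrow> real ^ 'm ^ 'm" where
  "energy_metric e u = (2 * e u / (u \<bullet> (hessian e u *v u))) *\<^sub>R hessian e u"

text \<open>Partial derivatives of a field on space-time, at the point \<open>(x, t)\<close>.\<close>

definition partial_t :: "((real ^ 'd) \<times> real \<Rightarrow> 'b::real_normed_vector) \<Rightarrow> real ^ 'd \<Rightarrow> real \<Rightarrow> 'b" where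
  "partial_t f x t = vector_derivative (\<lambda>s. f (x, s)) (at t)"

definition partial_x :: "'d \<Rightarrow> ((real ^ 'd) \<times> real \<Rightarrow> 'b::real_normed_vector) \<Rightarrow> real ^ 'd \<Rightarrow> real \<Rightarrow> 'b" where
  "partial_x k f x t = vector_derivative (\<lambda>s. f (x + s *\<^sub>R axis k 1, t)) (at 0)"

end

theory Submission
  imports Defs
begin

text \<open>
  The identity is the energy conservation law \<open>\<partial>\<^sub>t e + \<partial>\<^sub>k g\<^sub>k = 0\<close>, written out in terms of the
  quadratic representations of \<open>e\<close> and \<open>g\<^sub>k\<close>. Put \<open>N\<^sub>k = H (A\<^sub>k + \<Delta>A\<^sub>k)\<close>, which is \<open>G\<^sub>k\<close> on the
  admissible set, so that \<open>e(u) = 1/2 u \<bullet> H u\<close> and \<open>g\<^sub>k(u) = 1/2 u \<bullet> N\<^sub>k u\<close>.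

  Because \<open>H\<close> and \<open>N\<^sub>k\<close> are symmetric, the product rule (\<open>gradient_quadratic_form\<close>) turns the
  two derivatives into
  \<open>\<partial>\<^sub>t e = u \<bullet> H \<partial>\<^sub>t u + 1/2 u \<bullet> (\<partial>\<^sub>t H) u\<close> and
  \<open>\<partial>\<^sub>k g\<^sub>k = u \<bullet> N\<^sub>k \<partial>\<^sub>k u + 1/2 u \<bullet> (\<partial>\<^sub>k N\<^sub>k) u\<close>.
  The equation \<open>\<partial>\<^sub>t u = - \<Sum>\<^sub>k A\<^sub>k \<partial>\<^sub>k u\<close> enters twice. Combined with
  \<open>\<nabla>e\<^sup>T A\<^sub>k = \<nabla>g\<^sub>k\<^sup>T\<close> it gives the conservation law; inserted in \<open>u \<bullet> H \<partial>\<^sub>t u\<close> it cancels the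
  part \<open>u \<bullet> H A\<^sub>k \<partial>\<^sub>k u\<close> of the flux terms, which leaves only the defects \<open>\<Delta>A\<^sub>k\<close>.

  The analytic content is that \<open>H\<close> is differentiable: its entries are second derivatives
  of \<open>e\<close>, scaled by a quotient whose denominator is positive, since the Hessian is positive
  definite and \<open>0\<close> is not admissible.
\<close>

section \<open>Differentiability of the Hessian and of the energy metric\<close>

lemma smooth_on_imp_differentiable:
  assumes "smooth_on S f" "x \<in> S"
  shows "f differentiable (at x)"
proof -
  have "Ck_on (Suc 0) S f" using assms by (simp only: smooth_on_def)
  then show ?thesis using assms by simp
qed

lemma smooth_on_frechet_derivative:
  assumes "smooth_on S f"
  shows "smooth_on S (\<lambda>x. frechet_derivative f (at x) v)"
  unfolding smooth_on_def
proof
  fix n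
  have "Ck_on (Suc n) S f" using assms by (simp only: smooth_on_def)
  then show "Ck_on n S (\<lambda>x. frechet_derivative f (at x) v)" by simp
qed

lemma differentiable_transform_open:
  assumes "f differentiable (at x)" "open S" "x \<in> S" "\<And>y. y \<in> S \<Longrightarrow> f y = g y"
  shows "g differentiable (at x)"
  using assms has_derivative_transform_within_open unfolding differentiable_def by blast

lemma differentiable_vec_lambda:
  fixes f :: "'i::finite \<Rightarrow> 'a::real_normed_vector \<Rightarrow> 'b::euclidean_space"
  assumes "\<And>i. f i differentiable (at x)"
  shows "(\<lambda>y. \<chi> i. f i y) differentiable (at x)"
  by (subst differentiable_componentwise_within)
    (auto simp: Basis_vec_def inner_axis intro!: differentiable_inner assms)

lemma has_derivative_gradient:
  assumes "f differentiable (at u)"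
  shows "(f has_derivative (\<lambda>h. gradient f u \<bullet> h)) (at u)"
proof -
  let ?D = "frechet_derivative f (at u)"
  have D: "(f has_derivative ?D) (at u)"
    using assms by (simp add: frechet_derivative_works)
  have "linear ?D" using D by (rule has_derivative_linear)
  have "?D h = gradient f u \<bullet> h" for h
  proof -
    have "?D h = ?D (\<Sum>i\<in>UNIV. h $ i *\<^sub>R axis i 1)"
      by (simp add: basis_expansion[of h, unfolded scalar_mult_eq_scaleR])
    also have "\<dots> = (\<Sum>i\<in>UNIV. h $ i * ?D (axis i 1))"
      using \<open>linear ?D\<close> by (simp add: linear_sum linear_scale)
    finally show ?thesis
      by (simp add: gradient_def inner_vec_def mult.commute)
  qed
  then have "?D = (\<lambda>h. gradient f u \<bullet> h)" by blast
  with D show ?thesis by simp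
qed

lemma hessian_entry:
  assumes "smooth_on U f" "u \<in> U"
  shows "hessian f u $ i $ j =
    frechet_derivative (\<lambda>v. frechet_derivative f (at v) (axis i 1)) (at u) (axis j 1)"
proof -
  have comp: "(\<lambda>v. frechet_derivative f (at v) (axis i 1)) differentiable (at u)" for i
    using assms by (intro smooth_on_imp_differentiable[OF smooth_on_frechet_derivative])
  have "gradient f differentiable (at u)"
    unfolding gradient_def using comp by (rule differentiable_vec_lambda)
  then have "(gradient f has_derivative frechet_derivative (gradient f) (at u)) (at u)"
    by (simp add: frechet_derivative_works)
  then have "((\<lambda>v. gradient f v $ i) has_derivative
      (\<lambda>h. frechet_derivative (gradient f) (at u) h $ i)) (at u)"
    by (rule bounded_linear.has_derivative[OF bounded_linear_vec_nth])
  then have "frechet_derivative (\<lambda>v. gradient f v $ i) (at u) =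
      (\<lambda>h. frechet_derivative (gradient f) (at u) h $ i)"
    by (rule frechet_derivative_at[symmetric])
  then show ?thesis
    by (simp add: hessian_def jacobian_def matrix_def gradient_def)
qed

lemma hessian_differentiable:
  assumes "smooth_on U f" "open U" "u \<in> U"
  shows "hessian f differentiable (at u)"
proof (rule differentiable_transform_open[OF _ assms(2,3)])
  let ?E = "\<lambda>v. \<chi> i j. frechet_derivative
    (\<lambda>v. frechet_derivative f (at v) (axis i 1)) (at v) (axis j 1)"
  show "?E differentiable (at u)"
    by (intro differentiable_vec_lambda smooth_on_imp_differentiable[OF _ assms(3)]
        smooth_on_frechet_derivative assms(1))
  show "?E v = hessian f v" if "v \<in> U" for v
    using that by (simp add: vec_eq_iff hessian_entry[OF assms(1)])
qed

lemma bounded_bilinear_matrix_vector_mult: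
  "bounded_bilinear (\<lambda>(M::real^'n^'m) v. M *v v)"
  by (subst bilinear_conv_bounded_bilinear[symmetric])
    (auto simp: bilinear_def intro!: linearI
      simp: algebra_simps scaleR_matrix_vector_assoc)

lemmas has_derivative_matrix_vector_mult =
  bounded_bilinear.FDERIV[OF bounded_bilinear_matrix_vector_mult]

lemma energy_metric_differentiable:
  assumes "smooth_on U e" "open U" "u \<in> U" "u \<noteq> 0" "spd_matrix (hessian e u)"
  shows "energy_metric e differentiable (at u)"
proof -
  have hess: "hessian e differentiable (at u)"
    using assms by (intro hessian_differentiable)
  have "(\<lambda>v. hessian e v *v v) differentiable (at u)"
    using hess has_derivative_matrix_vector_mult has_derivative_ident
    unfolding differentiable_def by blast
  moreover have "u \<bullet> (hessian e u *v u) \<noteq> 0"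
    using assms by (auto simp: spd_matrix_def)
  ultimately show ?thesis
    unfolding energy_metric_def
    using hess smooth_on_imp_differentiable[OF assms(1,3)]
    by (intro differentiable_scaleR differentiable_divide differentiable_mult
        differentiable_inner differentiable_ident differentiable_const)
qed

lemma energy_metric_symmetric:
  assumes "symmetric_matrix (hessian e u)"
  shows "symmetric_matrix (energy_metric e u)"
  using assms by (simp add: symmetric_matrix_def energy_metric_def transpose_scalar)

text \<open>The scalar factor of the metric is chosen to make this normalization hold.\<close>

lemma energy_metric_represents:
  assumes "u \<noteq> 0" "spd_matrix (hessian e u)"
  shows "e u = (1/2) * (u \<bullet> (energy_metric e u *v u))"
proof -
  have "u \<bullet> (hessian e u *v u) \<noteq> 0"
    using assms by (auto simp: spd_matrix_def)
  then show ?thesis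
    by (simp add: energy_metric_def flip: scaleR_matrix_vector_assoc)
qed

section \<open>Derivatives of state-dependent quadratic forms\<close>

text \<open>
  The product rule produces the two terms \<open>h \<bullet> M(u) u\<close> and \<open>u \<bullet> M(u) h\<close>; symmetry of \<open>M(u)\<close>
  makes them equal, which absorbs the factor \<open>1/2\<close>. The form only has to represent \<open>f\<close>
  on a neighbourhood of \<open>u\<close>.
\<close>

lemma gradient_quadratic_form:
  fixes f :: "real ^ 'm \<Rightarrow> real"
  assumes U: "open U" "u \<in> U"
    and f: "\<And>v. v \<in> U \<Longrightarrow> f v = (1/2) * (v \<bullet> (M v *v v))"
    and M: "(M has_derivative M') (at u)"
    and sym: "symmetric_matrix (M u)"
  shows "gradient f u \<bullet> h = u \<bullet> (M u *v h) + (1/2) * (u \<bullet> (M' h *v u))"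
proof -
  have swap: "h \<bullet> (M u *v u) = u \<bullet> (M u *v h)" for h
    using sym unfolding symmetric_matrix_def
    by (metis dot_lmul_matrix inner_commute transpose_matrix_vector)
  have "((\<lambda>v. (1/2) * (v \<bullet> (M v *v v))) has_derivative
      (\<lambda>h. (1/2) * (u \<bullet> (M u *v h + M' h *v u) + h \<bullet> (M u *v u)))) (at u)"
    by (intro has_derivative_mult_right has_derivative_inner
        has_derivative_matrix_vector_mult has_derivative_ident M)
  then have D: "(f has_derivative
      (\<lambda>h. (1/2) * (u \<bullet> (M u *v h + M' h *v u) + h \<bullet> (M u *v u)))) (at u)"
    by (rule has_derivative_transform_within_open[OF _ U]) (simp add: f)
  then have "(f has_derivative (\<lambda>h. gradient f u \<bullet> h)) (at u)"
    by (intro has_derivative_gradient) (auto simp: differentiable_def)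
  from fun_cong[OF has_derivative_unique[OF this D], of h] show ?thesis
    by (simp add: swap inner_add_right algebra_simps)
qed

section \<open>The chain rule for the space and time derivatives\<close>

lemma partial_t_eq:
  assumes "(f has_derivative f') (at (x, t))"
  shows "partial_t f x t = f' (0, 1)"
proof -
  have "((\<lambda>s. (x, s)) has_vector_derivative (0, 1)) (at t)"
    by (auto intro!: derivative_eq_intros simp: has_vector_derivative_def)
  from vector_derivative_diff_chain_within[OF this has_derivative_at_withinI]
  show ?thesis
    using assms unfolding partial_t_def
    by (intro vector_derivative_at) (simp add: o_def)
qed

lemma partial_x_eq:
  assumes "(f has_derivative f') (at (x, t))"
  shows "partial_x k f x t = f' (axis k 1, 0)"
proof -
  have "((\<lambda>s. (x + s *\<^sub>R axis k 1, t)) has_vector_derivative (axis k 1, 0)) (at 0)"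
    by (auto intro!: derivative_eq_intros simp: has_vector_derivative_def)
  from vector_derivative_diff_chain_within[OF this has_derivative_at_withinI]
  show ?thesis
    using assms unfolding partial_x_def
    by (intro vector_derivative_at) (simp add: o_def)
qed

lemma
  assumes u: "u differentiable (at (x, t))"
    and \<phi>: "(\<phi> has_derivative \<phi>') (at (u (x, t)))"
  shows partial_t_compose: "partial_t (\<lambda>z. \<phi> (u z)) x t = \<phi>' (partial_t u x t)"
    and partial_x_compose: "partial_x k (\<lambda>z. \<phi> (u z)) x t = \<phi>' (partial_x k u x t)"
proof -
  obtain u' where u': "(u has_derivative u') (at (x, t))"
    using u by (auto simp: differentiable_def)
  have comp: "((\<lambda>z. \<phi> (u z)) has_derivative (\<lambda>h. \<phi>' (u' h))) (at (x, t))"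
    using u' \<phi> by (rule has_derivative_compose)
  show "partial_t (\<lambda>z. \<phi> (u z)) x t = \<phi>' (partial_t u x t)"
    by (simp add: partial_t_eq[OF comp] partial_t_eq[OF u'])
  show "partial_x k (\<lambda>z. \<phi> (u z)) x t = \<phi>' (partial_x k u x t)"
    by (simp add: partial_x_eq[OF comp] partial_x_eq[OF u'])
qed

section \<open>The energy identity\<close>

text \<open>
  The algebra at one point: \<open>p\<close> and \<open>q\<close> are the gradients of the energy and of its fluxes,
  \<open>r\<close> and \<open>s k\<close> are the time and space derivatives of the state, and \<open>\<alpha>\<close> and \<open>\<beta> k\<close> are the
  terms that come from differentiating the matrices of the quadratic forms.
\<close>

lemma defect_balance:
  fixes A D :: "'d::finite \<Rightarrow> real ^ 'm ^ 'm" and H :: "real ^ 'm ^ 'm"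
  assumes eq: "r + (\<Sum>k\<in>UNIV. A k *v s k) = 0"
    and pair: "\<And>k. p v* A k = q k"
    and time: "p \<bullet> r = w \<bullet> (H *v r) + \<alpha>"
    and space: "\<And>k. q k \<bullet> s k = w \<bullet> ((H ** (A k + D k)) *v s k) + \<beta> k"
  shows "(\<Sum>k\<in>UNIV. w \<bullet> ((H ** D k) *v s k)) + (\<alpha> + (\<Sum>k\<in>UNIV. \<beta> k)) = 0"
proof -
  have r: "r = - (\<Sum>k\<in>UNIV. A k *v s k)"
    using eq by (simp add: eq_neg_iff_add_eq_0)
  have "p \<bullet> r = - (\<Sum>k\<in>UNIV. q k \<bullet> s k)"
    by (simp add: r inner_sum_right dot_lmul_matrix flip: pair)
  moreover have "w \<bullet> (H *v r) = - (\<Sum>k\<in>UNIV. w \<bullet> ((H ** A k) *v s k))"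
    by (simp add: r inner_sum_right linear_neg[OF matrix_vector_mul_linear]
        linear_sum[OF matrix_vector_mul_linear] matrix_vector_mul_assoc)
  moreover have "(\<Sum>k\<in>UNIV. q k \<bullet> s k) = (\<Sum>k\<in>UNIV. w \<bullet> ((H ** A k) *v s k))
      + (\<Sum>k\<in>UNIV. w \<bullet> ((H ** D k) *v s k)) + (\<Sum>k\<in>UNIV. \<beta> k)"
    by (simp add: space matrix_add_ldistrib matrix_vector_mult_add_rdistrib
        inner_add_right sum.distrib)
  ultimately show ?thesis using time by simp
qed

theorem proposition2p6:
  fixes U :: "(real ^ 'm) set"
    and F :: "'d::finite \<Rightarrow> real ^ 'm \<Rightarrow> real ^ 'm"
    and A :: "'d \<Rightarrow> real ^ 'm \<Rightarrow> real ^ 'm ^ 'm"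
    and e :: "real ^ 'm \<Rightarrow> real"
    and g :: "'d \<Rightarrow> real ^ 'm \<Rightarrow> real"
    and H :: "real ^ 'm \<Rightarrow> real ^ 'm ^ 'm"
    and G :: "'d \<Rightarrow> real ^ 'm \<Rightarrow> real ^ 'm ^ 'm"
    and \<Delta>A :: "'d \<Rightarrow> real ^ 'm \<Rightarrow> real ^ 'm ^ 'm"
    and \<Omega> :: "((real ^ 'd) \<times> real) set"
    and u :: "(real ^ 'd) \<times> real \<Rightarrow> real ^ 'm"
  assumes U: "open U" "0 \<notin> U"
    and F_smooth: "\<And>k. smooth_on U (F k)"
    and A_def: "\<And>k v. v \<in> U \<Longrightarrow> A k v = jacobian (F k) (at v)"
    and e_smooth: "smooth_on U e"
    and g_smooth: "\<And>k. smooth_on U (g k)"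
    and e_pos: "\<And>v. v \<in> U \<Longrightarrow> e v > 0"
    and hessian_spd: "\<And>v. v \<in> U \<Longrightarrow> spd_matrix (hessian e v)"
    and energy_pair: "\<And>k v. v \<in> U \<Longrightarrow> gradient e v v* A k v = gradient (g k) v"
    and H_def: "\<And>v. v \<in> U \<Longrightarrow> H v = energy_metric e v"
    and G_smooth: "\<And>k. smooth_on U (G k)"
    and G_symmetric: "\<And>k v. v \<in> U \<Longrightarrow> symmetric_matrix (G k v)"
    and G_represents: "\<And>k v. v \<in> U \<Longrightarrow> g k v = (1/2) * (v \<bullet> (G k v *v v))"
    and \<Delta>A_def: "\<And>k v. v \<in> U \<Longrightarrow> G k v = H v ** (A k v + \<Delta>A k v)"
    and \<Omega>: "open \<Omega>"
    and u_smooth: "smooth_on \<Omega> u"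
    and u_admissible: "u ` \<Omega> \<subseteq> U"
    and u_solution: "\<And>x t. (x, t) \<in> \<Omega> \<Longrightarrow>
          partial_t u x t + (\<Sum>k\<in>UNIV. A k (u (x, t)) *v partial_x k u x t) = 0"
  shows "\<forall>x t. (x, t) \<in> \<Omega> \<longrightarrow>
     (\<Sum>k\<in>UNIV. u (x, t) \<bullet> ((H (u (x, t)) ** \<Delta>A k (u (x, t))) *v partial_x k u x t))
     + (1/2) * (u (x, t) \<bullet>
         ((partial_t (\<lambda>z. H (u z)) x t
           + (\<Sum>k\<in>UNIV. partial_x k (\<lambda>z. H (u z) ** (A k (u z) + \<Delta>A k (u z))) x t))
          *v u (x, t))) = 0"
proof (intro allI impI)
  fix x t
  assume xt: "(x, t) \<in> \<Omega>"
  define w where "w = u (x, t)"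
  have w: "w \<in> U" using u_admissible xt by (auto simp: w_def)
  have nz: "v \<noteq> 0" if "v \<in> U" for v using that U(2) by auto
  define N where "N k v = H v ** (A k v + \<Delta>A k v)" for k v
  have N: "N k v = G k v" if "v \<in> U" for k v
    using that \<Delta>A_def by (simp add: N_def)

  have u_diff: "u differentiable (at (x, t))"
    using u_smooth xt by (rule smooth_on_imp_differentiable)
  have "H differentiable (at w)"
    using energy_metric_differentiable[OF e_smooth U(1) w nz[OF w] hessian_spd[OF w]] U(1) w
    by (rule differentiable_transform_open) (simp add: H_def)
  then obtain H' where H': "(H has_derivative H') (at w)"
    by (auto simp: differentiable_def)
  have "N k differentiable (at w)" for k
    using smooth_on_imp_differentiable[OF G_smooth w] U(1) w
    by (rule differentiable_transform_open) (simp add: N)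
  then have "\<exists>N'. \<forall>k. (N k has_derivative N' k) (at w)"
    unfolding differentiable_def by (intro choice) blast
  then obtain N' where N': "\<And>k. (N k has_derivative N' k) (at w)" by blast

  let ?r = "partial_t u x t" and ?s = "\<lambda>k. partial_x k u x t"
  have e_rep: "e v = (1/2) * (v \<bullet> (H v *v v))" if "v \<in> U" for v
    using energy_metric_represents[OF nz hessian_spd] that by (simp add: H_def)
  have H_sym: "symmetric_matrix (H w)"
    using hessian_spd[OF w] by (simp add: H_def w spd_matrix_def energy_metric_symmetric)
  have time: "gradient e w \<bullet> ?r = w \<bullet> (H w *v ?r) + (1/2) * (w \<bullet> (H' ?r *v w))"
    using gradient_quadratic_form[OF U(1) w e_rep H' H_sym] .
  have space: "gradient (g k) w \<bullet> ?s k =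
      w \<bullet> ((H w ** (A k w + \<Delta>A k w)) *v ?s k) + (1/2) * (w \<bullet> (N' k (?s k) *v w))" for k
  proof -
    have "g k v = (1/2) * (v \<bullet> (N k v *v v))" if "v \<in> U" for v
      using that by (simp add: N G_represents)
    moreover have "symmetric_matrix (N k w)"
      using w by (simp add: N G_symmetric)
    ultimately show ?thesis
      using gradient_quadratic_form[OF U(1) w _ N'] by (simp add: N_def)
  qed
  have "?r + (\<Sum>k\<in>UNIV. A k w *v ?s k) = 0"
    using u_solution[OF xt] by (simp add: w_def)
  from defect_balance[OF this energy_pair[OF w] time space]
  have balance: "(\<Sum>k\<in>UNIV. w \<bullet> ((H w ** \<Delta>A k w) *v ?s k))
      + ((1/2) * (w \<bullet> (H' ?r *v w)) + (\<Sum>k\<in>UNIV. (1/2) * (w \<bullet> (N' k (?s k) *v w)))) = 0" .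

  have dt: "partial_t (\<lambda>z. H (u z)) x t = H' ?r"
    using partial_t_compose[OF u_diff] H' by (simp add: w_def)
  have dx: "partial_x k (\<lambda>z. H (u z) ** (A k (u z) + \<Delta>A k (u z))) x t = N' k (?s k)" for k
    using partial_x_compose[OF u_diff, of "N k"] N' by (simp add: w_def N_def)
  have "w \<bullet> ((H' ?r + (\<Sum>k\<in>UNIV. N' k (?s k))) *v w) =
      w \<bullet> (H' ?r *v w) + (\<Sum>k\<in>UNIV. w \<bullet> (N' k (?s k) *v w))"
    by (simp add: matrix_vector_mult_add_rdistrib inner_add_right inner_sum_right
        bounded_bilinear.sum_left[OF bounded_bilinear_matrix_vector_mult])
  then show "(\<Sum>k\<in>UNIV. u (x, t) \<bullet> ((H (u (x, t)) ** \<Delta>A k (u (x, t))) *v partial_x k u x t))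
     + (1/2) * (u (x, t) \<bullet>
         ((partial_t (\<lambda>z. H (u z)) x t
           + (\<Sum>k\<in>UNIV. partial_x k (\<lambda>z. H (u z) ** (A k (u z) + \<Delta>A k (u z))) x t))
          *v u (x, t))) = 0"
    using balance unfolding dt dx
    by (simp add: distrib_left sum_distrib_left flip: w_def)
qed

end
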